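(* Let $n\ge 1$, let $\omega_1,\dots,\omega_n$ be non-zero complex numbers, and let $P(x)=\prod_{k=1}^n (x-\omega_k)=\sum_{m=0}^n a_m x^m$. Let $N$ be an integer with $n<N\le 2n$ and let $\omega\in\mathbb{C}$ be a primitive $N$-th root of unity. (i) For $0\le m\le n$, $$a_m=\frac1N\sum_{0\le j<N}P(\omega^{-j})\,\omega^{jm},$$ and for $n<m<N$ the right-hand side of this formula equals $0$. (ii) Consequently Algorithm P, which first computes $p_j=\prod_{k=1}^n(\omega^{-j}-\omega_k)$ for $j=0,\dots,N-1$, then applies the discrete Fourier transform $(p_0,\dots,p_{N-1})\mapsto\left(\frac1N\sum_{0\le j<N}p_j\,\omega^{jm}\right)_{0\le m<N}$, and then outputs the first $n+1$ entries of the result, outputs $a_0,\dots,a_n$. When $N$ is a power of two and the transform is carried out by the radix-2 Cooley–Tukey fast Fourier transform, the algorithm requires $nN+O(N\log N)$ complex additions and $nN+O(N\log N)$ complex multiplications, hence $O(n^2)$ arithmetic operations, and complex storage $N+O(1)$, hence $O(n)$.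
   Context: Problem: compute the coefficients $a_0,\dots,a_n$ of the monic degree-$n$ polynomial $P$ from its roots $\omega_1,\dots,\omega_n$. Complexity is counted in exact complex arithmetic operations (subtractions count as additions). Storage is counted in complex numbers held in working memory, not counting the read-only input $\omega_1,\dots,\omega_n$; a primitive $N$-th root of unity is available as a constant. *)

theory Defs
  imports
    "HOL-Computational_Algebra.Polynomial"
    "HOL-Library.Landau_Symbols"
    Complex_Main
begin

definition primitive_root_of_unity :: "nat \<Rightarrow> complex \<Rightarrow> bool" where
  "primitive_root_of_unity N z \<longleftrightarrow> z ^ N = 1 \<and> (\<forall>k. 0 < k \<and> k < N \<longrightarrow> z ^ k \<noteq> 1)"


section \<open>Algorithm P as a mathematical map\<close>

text \<open>The roots are \<open>\<omega> 1, \<dots>, \<omega> n\<close>; \<open>z\<close> is the primitive \<open>N\<close>-th root of unity.\<close>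

definition evaluation :: "nat \<Rightarrow> nat \<Rightarrow> (nat \<Rightarrow> complex) \<Rightarrow> complex \<Rightarrow> complex list" where
  "evaluation n N \<omega> z = map (\<lambda>j. \<Prod>k=1..n. (z powi (- int j) - \<omega> k)) [0..<N]"

definition dft :: "nat \<Rightarrow> complex \<Rightarrow> complex list \<Rightarrow> complex list" where
  "dft N z p = map (\<lambda>m. 1 / of_nat N * (\<Sum>j<N. p ! j * z ^ (j * m))) [0..<N]"

definition algorithm_P :: "nat \<Rightarrow> nat \<Rightarrow> (nat \<Rightarrow> complex) \<Rightarrow> complex \<Rightarrow> complex list" where
  "algorithm_P n N \<omega> z = take (n + 1) (dft N z (evaluation n N \<omega> z))"


section \<open>The computational model\<close>

text \<open>
  Straight-line programs over a memory of complex cells addressed by natural numbers.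
  Each instruction writes its first argument. Operands may also be a read-only input
  (\<open>\<omega> k\<close>), the given root of unity, or a rational literal; these occupy no
  working memory. A program is a list of instructions that depends only on the sizes, never on
  the values of the inputs, so integer index arithmetic is free, and so is copying.
\<close>

datatype operand = Cell nat | Input nat | Unity_Root | Literal rat

datatype instruction =
    Copy nat operand
  | Add nat operand operand
  | Sub nat operand operand
  | Mul nat operand operand

type_synonym program = "instruction list"
type_synonym memory = "nat \<Rightarrow> complex"

fun operand_value :: "(nat \<Rightarrow> complex) \<Rightarrow> complex \<Rightarrow> memory \<Rightarrow> operand \<Rightarrow> complex" where
  "operand_value \<omega> z M (Cell i) = M i"
| "operand_value \<omega> z M (Input k) = \<omega> k"
| "operand_value \<omega> z M Unity_Root = z"
| "operand_value \<omega> z M (Literal q) = of_rat q"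

fun step :: "(nat \<Rightarrow> complex) \<Rightarrow> complex \<Rightarrow> instruction \<Rightarrow> memory \<Rightarrow> memory" where
  "step \<omega> z (Copy d a) M = M(d := operand_value \<omega> z M a)"
| "step \<omega> z (Add d a b) M = M(d := operand_value \<omega> z M a + operand_value \<omega> z M b)"
| "step \<omega> z (Sub d a b) M = M(d := operand_value \<omega> z M a - operand_value \<omega> z M b)"
| "step \<omega> z (Mul d a b) M = M(d := operand_value \<omega> z M a * operand_value \<omega> z M b)"

definition execute :: "(nat \<Rightarrow> complex) \<Rightarrow> complex \<Rightarrow> program \<Rightarrow> memory \<Rightarrow> memory" where
  "execute \<omega> z prg M = fold (step \<omega> z) prg M"

fun is_addition :: "instruction \<Rightarrow> bool" where
  "is_addition (Add d a b) = True"
| "is_addition (Sub d a b) = True"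
| "is_addition (Mul d a b) = False"
| "is_addition (Copy d a) = False"

fun is_multiplication :: "instruction \<Rightarrow> bool" where
  "is_multiplication (Mul d a b) = True"
| "is_multiplication (Add d a b) = False"
| "is_multiplication (Sub d a b) = False"
| "is_multiplication (Copy d a) = False"

definition additions :: "program \<Rightarrow> nat" where
  "additions prg = length (filter is_addition prg)"

definition multiplications :: "program \<Rightarrow> nat" where
  "multiplications prg = length (filter is_multiplication prg)"

fun operand_cells :: "operand \<Rightarrow> nat set" where
  "operand_cells (Cell i) = {i}"
| "operand_cells (Input k) = {}"
| "operand_cells Unity_Root = {}"
| "operand_cells (Literal q) = {}"

fun instruction_cells :: "instruction \<Rightarrow> nat set" where
  "instruction_cells (Copy d a) = {d} \<union> operand_cells a"
| "instruction_cells (Add d a b) = {d} \<union> operand_cells a \<union> operand_cells b"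
| "instruction_cells (Sub d a b) = {d} \<union> operand_cells a \<union> operand_cells b"
| "instruction_cells (Mul d a b) = {d} \<union> operand_cells a \<union> operand_cells b"

definition storage :: "program \<Rightarrow> nat" where
  "storage prg = card (\<Union>instr\<in>set prg. instruction_cells instr)"


section \<open>Algorithm P with the radix-2 fast Fourier transform, as a program\<close>

text \<open>
  Cells \<open>0, \<dots>, N - 1\<close> hold the data; the cells \<open>N, \<dots>, N + 4\<close> are scratch space.
\<close>

text \<open>
  Scratch cell \<open>N + 1\<close> receives \<open>z\<^sup>N\<^sup>-\<^sup>1\<close>, which is the inverse of \<open>z\<close>; cell \<open>N\<close> runs through its
  powers.
\<close>

definition evaluation_program :: "nat \<Rightarrow> nat \<Rightarrow> program" where
  "evaluation_program n N =
     [Copy (N + 1) (Literal 1)]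
     @ replicate (N - 1) (Mul (N + 1) (Cell (N + 1)) Unity_Root)
     @ [Copy N (Literal 1)]
     @ concat (map (\<lambda>j.
         [Copy j (Literal 1)]
         @ concat (map (\<lambda>k.
             [Sub (N + 2) (Cell N) (Input k),
              Mul j (Cell j) (Cell (N + 2))]) [1..<n + 1])
         @ [Mul N (Cell N) (Cell (N + 1))]) [0..<N])"

fun bit_reverse :: "nat \<Rightarrow> nat \<Rightarrow> nat" where
  "bit_reverse 0 i = 0"
| "bit_reverse (Suc s) i = (i mod 2) * 2 ^ s + bit_reverse s (i div 2)"

definition bit_reversal_program :: "nat \<Rightarrow> program" where
  "bit_reversal_program L = concat (map (\<lambda>i.
     if i < bit_reverse L i then
       [Copy (2 ^ L + 2) (Cell i),
        Copy i (Cell (bit_reverse L i)),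
        Copy (bit_reverse L i) (Cell (2 ^ L + 2))]
     else []) [0..<2 ^ L])"

text \<open>
  One combining step of the decimation-in-time recursion, for a transform of length
  \<open>2 ^ Suc s\<close> whose two halves have been transformed already: \<open>L - Suc s\<close> squarings of the given
  root produce its root of unity (scratch cell \<open>2 ^ L + 3\<close>), the twiddle factor runs through the
  powers of the latter (cell \<open>2 ^ L + 4\<close>), and the \<open>2 ^ s\<close> butterflies are done in place.
\<close>

definition butterflies_program :: "nat \<Rightarrow> nat \<Rightarrow> nat \<Rightarrow> program" where
  "butterflies_program L s b =
     [Copy (2 ^ L + 3) Unity_Root]
     @ replicate (L - Suc s) (Mul (2 ^ L + 3) (Cell (2 ^ L + 3)) (Cell (2 ^ L + 3)))
     @ [Copy (2 ^ L + 4) (Literal 1)]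
     @ concat (map (\<lambda>k.
         [Mul (2 ^ L + 2) (Cell (2 ^ L + 4)) (Cell (b + 2 ^ s + k)),
          Sub (b + 2 ^ s + k) (Cell (b + k)) (Cell (2 ^ L + 2)),
          Add (b + k) (Cell (b + k)) (Cell (2 ^ L + 2)),
          Mul (2 ^ L + 4) (Cell (2 ^ L + 4)) (Cell (2 ^ L + 3))]) [0..<2 ^ s])"

text \<open>The transform of length \<open>2 ^ s\<close> of the data at cells \<open>b, \<dots>, b + 2 ^ s - 1\<close>, which are
  expected in bit-reversed order.\<close>

fun cooley_tukey_program :: "nat \<Rightarrow> nat \<Rightarrow> nat \<Rightarrow> program" where
  "cooley_tukey_program L 0 b = []"
| "cooley_tukey_program L (Suc s) b =
     cooley_tukey_program L s b
     @ cooley_tukey_program L s (b + 2 ^ s)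
     @ butterflies_program L s b"

definition fft_program :: "nat \<Rightarrow> program" where
  "fft_program L =
     bit_reversal_program L
     @ cooley_tukey_program L L 0
     @ map (\<lambda>m. Mul m (Cell m) (Literal (1 / of_nat (2 ^ L)))) [0..<2 ^ L]"

text \<open>The output consists of the cells \<open>0, \<dots>, n\<close> after execution.\<close>

definition algorithm_P_program :: "nat \<Rightarrow> nat \<Rightarrow> program" where
  "algorithm_P_program n L = evaluation_program n (2 ^ L) @ fft_program L"

text \<open>
  Pairs \<open>(n, L)\<close> for which \<open>N = 2 ^ L\<close> is an allowed transform length. Landau symbols with respect
  to the filter \<open>principal fft_sizes\<close> are bounds with one constant that is valid for all such
  pairs.
\<close>

definition fft_sizes :: "(nat \<times> nat) set" where
  "fft_sizes = {(n, L). 1 \<le> n \<and> n < 2 ^ L \<and> 2 ^ L \<le> 2 * n}"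

end

theory Submission
  imports Defs
begin

text \<open>
  The polynomial \<open>P\<close> is determined by its values at the \<open>N\<close>-th roots of unity, because its degree
  is below \<open>N\<close>: substituting \<open>P(x) = \<Sum> a\<^sub>i x\<^sup>i\<close> in the discrete Fourier transform of these values and
  exchanging the sums leaves geometric sums of roots of unity, which select the single index
  \<open>i = m\<close> (\<open>orthogonality\<close>, \<open>interpolation_formula\<close>). The coefficients with \<open>n < m < N\<close> are zero
  since \<open>P\<close> has degree \<open>n\<close>.

  The programs are verified by loop invariants. The heart of the matter is
  \<open>execute_cooley_tukey\<close>: by induction on \<open>s\<close>, the recursive program turns a block of length
  \<open>2 ^ s\<close> into the transform of the bit-reversed block. Splitting the defining sum into even and
  odd indices matches the two recursive calls, and \<open>w ^ (2 ^ s) = -1\<close> lets one product serve two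
  outputs in a butterfly. Since bit reversal is an involution, the permutation that is done
  beforehand cancels the one in this invariant.

  For the costs, the evaluation phase performs \<open>n\<close> subtractions and \<open>n\<close> multiplications for each
  of the \<open>N\<close> points, plus \<open>O(N)\<close> multiplications for the points themselves. The transform satisfies
  the recurrence \<open>T(s + 1) = 2 T(s) + O(2 ^ s)\<close>, up to the squarings that produce the root of unity
  of each combining step; these contribute at most \<open>L 2 ^ L\<close> in total. Together this gives
  \<open>n N + O(N log N)\<close>, and \<open>N \<le> 2 n\<close> turns this into \<open>O(n\<^sup>2)\<close>.
\<close>

section \<open>Inversion of the discrete Fourier transform\<close>

lemma primitive_root_powers_inj:
  assumes "primitive_root_of_unity N z" "i < N" "m < N" "z ^ i = z ^ m"
  shows "i = m"
proof -
  have z0: "z \<noteq> 0"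
    using assms unfolding primitive_root_of_unity_def by (cases "z = 0") (auto simp: zero_power)
  have le: "a = b" if "a \<le> b" "b < N" "z ^ a = z ^ b" for a b
  proof (rule ccontr)
    assume "a \<noteq> b"
    moreover have "z ^ (b - a) = 1"
      using that z0 by (simp add: power_diff)
    ultimately show False
      using that assms(1) unfolding primitive_root_of_unity_def
      by (metis diff_is_0_eq le_neq_implies_less less_imp_diff_less not_gr_zero not_le)
  qed
  show ?thesis
    using le[of i m] le[of m i] assms by (cases "i \<le> m") auto
qed

text \<open>The ratio \<open>r = z\<^sup>m / z\<^sup>i\<close> of the geometric sum satisfies \<open>r\<^sup>N = 1\<close>, so the sum vanishes
  unless \<open>r = 1\<close>, and primitivity excludes \<open>r = 1\<close> for distinct exponents below \<open>N\<close>.\<close>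

lemma orthogonality:
  assumes "primitive_root_of_unity N z" "i < N" "m < N"
  shows "(\<Sum>j<N. (z powi (- int j)) ^ i * z ^ (j * m)) = (if i = m then of_nat N else 0)"
proof -
  have z0: "z \<noteq> 0"
    using assms unfolding primitive_root_of_unity_def by (cases "z = 0") (auto simp: zero_power)
  have zN: "z ^ N = 1"
    using assms unfolding primitive_root_of_unity_def by simp
  define r where "r = z ^ m / z ^ i"
  have term_eq: "(z powi (- int j)) ^ i * z ^ (j * m) = r ^ j" for j
    using z0 by (simp add: r_def power_int_minus power_divide field_simps flip: power_mult)
  have r1: "r = 1 \<longleftrightarrow> i = m"
    using primitive_root_powers_inj[OF assms(1) assms(2,3)] z0 by (auto simp: r_def)
  have rN: "r ^ N = 1"
    using zN unfolding r_def by (metis power_divide power_mult mult.commute power_one div_by_1)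
  show ?thesis
    using r1 rN by (auto simp: term_eq geometric_sum)
qed

lemma interpolation_formula:
  assumes "primitive_root_of_unity N z" "degree P < N" "m < N"
  shows "1 / of_nat N * (\<Sum>j<N. poly P (z powi (- int j)) * z ^ (j * m)) = coeff P m"
proof -
  have "(\<Sum>j<N. poly P (z powi (- int j)) * z ^ (j * m))
      = (\<Sum>j<N. \<Sum>i\<le>degree P. coeff P i * ((z powi (- int j)) ^ i * z ^ (j * m)))"
    by (simp add: poly_altdef sum_distrib_right mult.assoc)
  also have "\<dots> = (\<Sum>i\<le>degree P. coeff P i * (\<Sum>j<N. (z powi (- int j)) ^ i * z ^ (j * m)))"
    by (subst sum.swap) (simp add: sum_distrib_left)
  also have "\<dots> = (\<Sum>i\<le>degree P. coeff P i * (if i = m then of_nat N else 0))"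
    using assms by (intro sum.cong refl) (simp add: orthogonality)
  also have "\<dots> = (\<Sum>i\<le>degree P. if i = m then coeff P m * of_nat N else 0)"
    by (intro sum.cong) auto
  also have "\<dots> = coeff P m * of_nat N"
    by (auto simp: coeff_eq_0)
  finally show ?thesis
    using assms by simp
qed

lemma degree_prod_monic_linear: "degree (\<Prod>k=1..n. [:- (\<omega> k :: complex), 1:]) = n"
  by (subst degree_prod_eq_sum_degree) auto

lemma evaluation_nth:
  "j < N \<Longrightarrow> evaluation n N \<omega> z ! j = poly (\<Prod>k=1..n. [:- \<omega> k, 1:]) (z powi (- int j))"
  by (simp add: evaluation_def poly_prod)

lemma algorithm_P_correct:
  assumes "primitive_root_of_unity N z" "n < N"
  shows "algorithm_P n N \<omega> z = map (coeff (\<Prod>k=1..n. [:- \<omega> k, 1:])) [0..<n + 1]"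
proof -
  define P where "P = (\<Prod>k=1..n. [:- \<omega> k, 1:])"
  have "degree P < N"
    using assms(2) by (simp only: P_def degree_prod_monic_linear)
  moreover have "evaluation n N \<omega> z ! j = poly P (z powi (- int j))" if "j < N" for j
    unfolding P_def using that by (rule evaluation_nth)
  ultimately have "dft N z (evaluation n N \<omega> z) = map (coeff P) [0..<N]"
    using interpolation_formula[OF assms(1), of P] by (simp add: dft_def)
  then show ?thesis
    using assms(2) by (simp add: algorithm_P_def take_map P_def del: upt_Suc)
qed


section \<open>Execution of programs\<close>

lemma execute_Nil [simp]: "execute \<omega> z [] M = M"
  by (simp add: execute_def)

lemma execute_Cons [simp]: "execute \<omega> z (i # prg) M = execute \<omega> z prg (step \<omega> z i M)"
  by (simp add: execute_def)

lemma execute_append [simp]: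
  "execute \<omega> z (prg @ prg') M = execute \<omega> z prg' (execute \<omega> z prg M)"
  by (simp add: execute_def)

lemma execute_power:
  "execute \<omega> z (replicate m (Mul c (Cell c) Unity_Root)) M = M(c := M c * z ^ m)"
  by (induction m arbitrary: M) (auto simp: mult_ac)

lemma execute_repeated_squaring:
  "execute \<omega> z (replicate m (Mul c (Cell c) (Cell c))) M = M(c := M c ^ (2 ^ m))"
  by (induction m arbitrary: M) (auto simp: power_mult power2_eq_square)


section \<open>Correctness of the evaluation phase\<close>

lemma execute_root_product:
  fixes j N n :: nat and \<omega> :: "nat \<Rightarrow> complex" and z :: complex and M :: memory
  assumes "j < N"
  defines "M' \<equiv> execute \<omega> z (concat (map (\<lambda>k.
             [Sub (N + 2) (Cell N) (Input k), Mul j (Cell j) (Cell (N + 2))]) [1..<n + 1])) M"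
  shows "M' j = M j * (\<Prod>k=1..n. (M N - \<omega> k))"
    and "i \<noteq> j \<Longrightarrow> i \<noteq> N + 2 \<Longrightarrow> M' i = M i"
proof -
  have "M' j = M j * (\<Prod>k=1..n. (M N - \<omega> k)) \<and> (\<forall>i. i \<noteq> j \<and> i \<noteq> N + 2 \<longrightarrow> M' i = M i)"
    unfolding M'_def using assms(1)
    by (induction n) (auto simp: mult_ac)
  then show "M' j = M j * (\<Prod>k=1..n. (M N - \<omega> k))"
    and "i \<noteq> j \<Longrightarrow> i \<noteq> N + 2 \<Longrightarrow> M' i = M i"
    by auto
qed

lemma execute_evaluation_loop:
  fixes N n K :: nat and \<omega> :: "nat \<Rightarrow> complex" and z :: complex and M :: memory
  assumes "K \<le> N" "M N = 1"
  defines "M' \<equiv> execute \<omega> z (concat (map (\<lambda>j.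
         [Copy j (Literal 1)]
         @ concat (map (\<lambda>k.
             [Sub (N + 2) (Cell N) (Input k),
              Mul j (Cell j) (Cell (N + 2))]) [1..<n + 1])
         @ [Mul N (Cell N) (Cell (N + 1))]) [0..<K])) M"
  shows "M' N = M (N + 1) ^ K \<and> M' (N + 1) = M (N + 1) \<and>
         (\<forall>i<K. M' i = (\<Prod>k=1..n. (M (N + 1) ^ i - \<omega> k)))"
  using assms(1) unfolding M'_def
proof (induction K)
  case 0
  then show ?case using assms(2) by simp
next
  case (Suc K)
  define body where "body = (\<lambda>j. [Copy j (Literal 1)]
         @ concat (map (\<lambda>k.
             [Sub (N + 2) (Cell N) (Input k),
              Mul j (Cell j) (Cell (N + 2))]) [1..<n + 1])
         @ [Mul N (Cell N) (Cell (N + 1))])"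
  define M1 where "M1 = execute \<omega> z (concat (map body [0..<K])) M"
  define M2 where "M2 = execute \<omega> z (body K) M1"
  have "K < N" using Suc.prems by simp
  have IH: "M1 N = M (N + 1) ^ K" "M1 (N + 1) = M (N + 1)"
    "\<forall>i<K. M1 i = (\<Prod>k=1..n. (M (N + 1) ^ i - \<omega> k))"
    using Suc unfolding M1_def body_def by auto
  note inner = execute_root_product[OF \<open>K < N\<close>, where \<omega> = \<omega> and z = z and n = n and M = "M1(K := 1)"]
  have "M2 N = M (N + 1) ^ Suc K" "M2 (N + 1) = M (N + 1)"
    "M2 K = (\<Prod>k=1..n. (M (N + 1) ^ K - \<omega> k))" "\<And>i. i < K \<Longrightarrow> M2 i = M1 i"
    unfolding M2_def body_def
    using \<open>K < N\<close> inner IH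
    by (simp_all del: upt_Suc)
  then have "M2 N = M (N + 1) ^ Suc K \<and> M2 (N + 1) = M (N + 1) \<and>
         (\<forall>i<Suc K. M2 i = (\<Prod>k=1..n. (M (N + 1) ^ i - \<omega> k)))"
    using IH(3) by (auto simp: less_Suc_eq)
  moreover have "M2 = execute \<omega> z (concat (map body [0..<Suc K])) M"
    by (simp add: M2_def M1_def)
  ultimately show ?case
    unfolding body_def by blast
qed

lemma evaluation_program_correct:
  assumes "z ^ N = 1" "0 < N"
  shows "map (execute \<omega> z (evaluation_program n N) M) [0..<N] = evaluation n N \<omega> z"
proof -
  have "z ^ (N - 1) * z = 1"
    using assms by (cases N) (auto simp: mult_ac)
  then have inv: "z ^ (N - Suc 0) = inverse z"
    using inverse_unique[of z "z ^ (N - 1)"] by (simp add: mult.commute)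
  define M1 where "M1 = execute \<omega> z ([Copy (N + 1) (Literal 1)]
     @ replicate (N - 1) (Mul (N + 1) (Cell (N + 1)) Unity_Root) @ [Copy N (Literal 1)]) M"
  have M1: "M1 N = 1" "M1 (N + 1) = inverse z"
    by (simp_all add: M1_def execute_power inv)
  have "execute \<omega> z (evaluation_program n N) M i = (\<Prod>k=1..n. (inverse z ^ i - \<omega> k))"
    if "i < N" for i
    using execute_evaluation_loop[where M = M1 and N = N and \<omega> = \<omega> and z = z and n = n, OF order_refl M1(1)] that M1
    by (simp add: evaluation_program_def M1_def del: upt_Suc)
  then show ?thesis
    by (simp add: evaluation_def power_int_minus power_inverse)
qed


section \<open>Bit reversal\<close>

lemma bit_reverse_less: "bit_reverse s i < 2 ^ s"
proof (induction s arbitrary: i)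
  case (Suc s)
  have "i mod 2 = 0 \<or> i mod 2 = 1" by auto
  then show ?case using Suc[of "i div 2"] by auto
qed simp

text \<open>The recursion peels off the lowest bit of the argument; this is the same recursion seen
  from the highest bit, which is what a second reversal meets.\<close>

lemma bit_reverse_top_bit:
  assumes "r < 2 ^ s" "q < 2"
  shows "bit_reverse (Suc s) (q * 2 ^ s + r) = 2 * bit_reverse s r + q"
  using assms
proof (induction s arbitrary: r)
  case (Suc s)
  have div: "(q * 2 ^ Suc s + r) div 2 = q * 2 ^ s + r div 2"
    and mod: "(q * 2 ^ Suc s + r) mod 2 = r mod 2"
    by (auto simp: mult.left_commute[of q 2] mod_mult_self4)
  have "bit_reverse (Suc (Suc s)) (q * 2 ^ Suc s + r)
      = (r mod 2) * 2 ^ Suc s + bit_reverse (Suc s) (q * 2 ^ s + r div 2)"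
    by (simp only: bit_reverse.simps(2)[of "Suc s"] div mod)
  also have "bit_reverse (Suc s) (q * 2 ^ s + r div 2) = 2 * bit_reverse s (r div 2) + q"
    using Suc by (intro Suc.IH) auto
  finally show ?case by simp
qed auto

lemma bit_reverse_involution: "i < 2 ^ s \<Longrightarrow> bit_reverse s (bit_reverse s i) = i"
proof (induction s arbitrary: i)
  case (Suc s)
  have "bit_reverse (Suc s) (bit_reverse (Suc s) i)
      = bit_reverse (Suc s) ((i mod 2) * 2 ^ s + bit_reverse s (i div 2))"
    by simp
  also have "\<dots> = 2 * bit_reverse s (bit_reverse s (i div 2)) + i mod 2"
    by (intro bit_reverse_top_bit bit_reverse_less) simp
  also have "\<dots> = i"
    using Suc.prems by (subst Suc.IH) auto
  finally show ?case .
qed simp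

text \<open>Each two-element orbit of the involution is swapped exactly once, when the loop meets its
  smaller element; hence the loop invariant distinguishes the cells by the smaller element of
  their orbit.\<close>

lemma execute_bit_reversal_loop:
  fixes K L i :: nat and \<omega> :: "nat \<Rightarrow> complex" and z :: complex and M :: memory
  assumes "K \<le> 2 ^ L" "i < 2 ^ L"
  shows "execute \<omega> z (concat (map (\<lambda>i.
     if i < bit_reverse L i then
       [Copy (2 ^ L + 2) (Cell i),
        Copy i (Cell (bit_reverse L i)),
        Copy (bit_reverse L i) (Cell (2 ^ L + 2))]
     else []) [0..<K])) M i
     = (if min i (bit_reverse L i) < K then M (bit_reverse L i) else M i)"
  using assms
proof (induction K arbitrary: i)
  case (Suc K)
  define R where "R = bit_reverse L"
  have inv: "R (R k) = k" "R k < 2 ^ L" if "k < 2 ^ L" for k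
    using that by (simp_all add: R_def bit_reverse_involution bit_reverse_less)
  define body where "body = (\<lambda>i. if i < R i then
       [Copy (2 ^ L + 2) (Cell i), Copy i (Cell (R i)), Copy (R i) (Cell (2 ^ L + 2))]
     else [])"
  define M1 where "M1 = execute \<omega> z (concat (map body [0..<K])) M"
  define M2 where "M2 = execute \<omega> z (body K) M1"
  have K: "K < 2 ^ L" and i: "i < 2 ^ L" using Suc.prems by auto
  have IH: "M1 k = (if min k (R k) < K then M (R k) else M k)" if "k < 2 ^ L" for k
    using Suc.IH[of k] K that unfolding M1_def body_def R_def by simp
  have swap: "M2 k = (if K < R K \<and> k = K then M1 (R K) else if K < R K \<and> k = R K then M1 K else M1 k)"
    if "k < 2 ^ L" for k
    using that K inv(2)[OF K] by (auto simp: M2_def body_def)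
  have "M2 i = (if min i (R i) < Suc K then M (R i) else M i)"
  proof -
    consider "i = K" | "i = R K" "i \<noteq> K" | "i \<noteq> K" "R i \<noteq> K"
      using inv[OF i] by metis
    then show ?thesis
    proof cases
      case 1
      then show ?thesis
        using K inv[OF K] by (auto simp: swap IH min_def)
    next
      case 2
      then show ?thesis
        using K inv[OF K] by (auto simp: swap IH min_def)
    next
      case 3
      then have "i \<noteq> R K" using inv[OF K] by auto
      moreover have "min i (R i) < Suc K \<longleftrightarrow> min i (R i) < K"
        using 3 by (auto simp: min_def)
      ultimately show ?thesis
        using 3 by (simp add: swap[OF i] IH[OF i])
    qed
  qed
  moreover have "M2 = execute \<omega> z (concat (map body [0..<Suc K])) M"
    by (simp add: M2_def M1_def)
  ultimately show ?case
    by (simp only: body_def R_def)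
qed simp

lemma execute_bit_reversal:
  "i < 2 ^ L \<Longrightarrow> execute \<omega> z (bit_reversal_program L) M i = M (bit_reverse L i)"
  unfolding bit_reversal_program_def
  by (subst execute_bit_reversal_loop) (auto simp: min_def bit_reverse_less)


section \<open>Correctness of the fast Fourier transform\<close>

lemma execute_butterfly_loop:
  fixes L s b K :: nat and \<omega> :: "nat \<Rightarrow> complex" and z :: complex and M :: memory
  assumes "K \<le> 2 ^ s" "b + 2 ^ Suc s \<le> 2 ^ L" "M (2 ^ L + 4) = 1"
  defines "w \<equiv> M (2 ^ L + 3)"
  defines "M' \<equiv> execute \<omega> z (concat (map (\<lambda>k.
         [Mul (2 ^ L + 2) (Cell (2 ^ L + 4)) (Cell (b + 2 ^ s + k)),
          Sub (b + 2 ^ s + k) (Cell (b + k)) (Cell (2 ^ L + 2)),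
          Add (b + k) (Cell (b + k)) (Cell (2 ^ L + 2)),
          Mul (2 ^ L + 4) (Cell (2 ^ L + 4)) (Cell (2 ^ L + 3))]) [0..<K])) M"
  shows "M' (2 ^ L + 3) = w \<and> M' (2 ^ L + 4) = w ^ K \<and>
         (\<forall>k<K. M' (b + k) = M (b + k) + w ^ k * M (b + 2 ^ s + k)) \<and>
         (\<forall>k<K. M' (b + 2 ^ s + k) = M (b + k) - w ^ k * M (b + 2 ^ s + k)) \<and>
         (\<forall>i<2 ^ L. i \<notin> {b..<b + K} \<union> {b + 2 ^ s..<b + 2 ^ s + K} \<longrightarrow> M' i = M i)"
  using assms(1) unfolding M'_def
proof (induction K)
  case 0
  then show ?case using assms(3) by (simp add: w_def)
next
  case (Suc K)
  then show ?case
    using assms(2) by (auto simp: less_Suc_eq)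
qed

lemma execute_butterflies:
  fixes L s b :: nat and \<omega> :: "nat \<Rightarrow> complex" and z :: complex and M :: memory
  assumes "b + 2 ^ Suc s \<le> 2 ^ L"
  defines "w \<equiv> z ^ (2 ^ (L - Suc s))"
  defines "M' \<equiv> execute \<omega> z (butterflies_program L s b) M"
  shows "k < 2 ^ s \<Longrightarrow> M' (b + k) = M (b + k) + w ^ k * M (b + 2 ^ s + k)"
    and "k < 2 ^ s \<Longrightarrow> M' (b + 2 ^ s + k) = M (b + k) - w ^ k * M (b + 2 ^ s + k)"
    and "i < 2 ^ L \<Longrightarrow> i \<notin> {b..<b + 2 ^ Suc s} \<Longrightarrow> M' i = M i"
proof -
  define M1 where "M1 = M(2 ^ L + 3 := w, 2 ^ L + 4 := 1)"
  have M1: "M1 (2 ^ L + 4) = 1" "M1 (2 ^ L + 3) = w" "\<And>i. i < 2 ^ L \<Longrightarrow> M1 i = M i"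
    by (auto simp: M1_def)
  have M1_exec: "execute \<omega> z ([Copy (2 ^ L + 3) Unity_Root]
      @ replicate (L - Suc s) (Mul (2 ^ L + 3) (Cell (2 ^ L + 3)) (Cell (2 ^ L + 3)))
      @ [Copy (2 ^ L + 4) (Literal 1)]) M = M1"
    by (auto simp: execute_repeated_squaring w_def M1_def fun_eq_iff)
  note loop = execute_butterfly_loop[where M = M1 and L = L and \<omega> = \<omega> and z = z, OF order_refl assms(1) M1(1)]
  have M': "M' = execute \<omega> z (concat (map (\<lambda>k.
         [Mul (2 ^ L + 2) (Cell (2 ^ L + 4)) (Cell (b + 2 ^ s + k)),
          Sub (b + 2 ^ s + k) (Cell (b + k)) (Cell (2 ^ L + 2)),
          Add (b + k) (Cell (b + k)) (Cell (2 ^ L + 2)),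
          Mul (2 ^ L + 4) (Cell (2 ^ L + 4)) (Cell (2 ^ L + 3))]) [0..<2 ^ s])) M1"
    unfolding M'_def butterflies_program_def M1_exec[symmetric] by simp
  show "k < 2 ^ s \<Longrightarrow> M' (b + k) = M (b + k) + w ^ k * M (b + 2 ^ s + k)"
    and "k < 2 ^ s \<Longrightarrow> M' (b + 2 ^ s + k) = M (b + k) - w ^ k * M (b + 2 ^ s + k)"
    using loop assms(1) M1 unfolding M' by auto
  show "i < 2 ^ L \<Longrightarrow> i \<notin> {b..<b + 2 ^ Suc s} \<Longrightarrow> M' i = M i"
    using loop assms(1) M1 unfolding M' by auto
qed

lemma sum_even_odd:
  fixes f :: "nat \<Rightarrow> 'a :: comm_monoid_add"
  shows "(\<Sum>j<2 * n. f j) = (\<Sum>j<n. f (2 * j)) + (\<Sum>j<n. f (2 * j + 1))"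
  by (induction n) (simp_all add: ac_simps)

text \<open>Primitivity of the root excludes the value \<open>1\<close> for this square root of \<open>1\<close>; the minus sign that
  remains is the one in the butterflies.\<close>

lemma primitive_root_half_power:
  assumes "primitive_root_of_unity (2 ^ Suc l) z"
  shows "z ^ (2 ^ l) = -1"
proof -
  have "(z ^ (2 ^ l))\<^sup>2 = 1"
    using assms unfolding primitive_root_of_unity_def
    by (simp add: power_mult[symmetric] mult.commute)
  moreover have "z ^ (2 ^ l) \<noteq> 1"
    using assms unfolding primitive_root_of_unity_def by simp
  ultimately show ?thesis
    by (simp add: power2_eq_1_iff)
qed

text \<open>The claim that all other data cells are unchanged is what keeps the two recursive calls,
  which share the scratch cells, from disturbing each other's block.\<close>

lemma execute_cooley_tukey:
  fixes L s b :: nat and \<omega> :: "nat \<Rightarrow> complex" and z :: complex and M :: memory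
  assumes "primitive_root_of_unity (2 ^ L) z" "s \<le> L" "b + 2 ^ s \<le> 2 ^ L"
  defines "M' \<equiv> execute \<omega> z (cooley_tukey_program L s b) M"
  shows "(\<forall>m<2 ^ s. M' (b + m) =
            (\<Sum>j<2 ^ s. M (b + bit_reverse s j) * (z ^ (2 ^ (L - s))) ^ (j * m))) \<and>
         (\<forall>i<2 ^ L. i \<notin> {b..<b + 2 ^ s} \<longrightarrow> M' i = M i)"
  using assms(2,3) unfolding M'_def
proof (induction s arbitrary: b M)
  case (Suc s)
  define M1 where "M1 = execute \<omega> z (cooley_tukey_program L s b) M"
  define M2 where "M2 = execute \<omega> z (cooley_tukey_program L s (b + 2 ^ s)) M1"
  define M3 where "M3 = execute \<omega> z (butterflies_program L s b) M2"
  define w where "w = z ^ (2 ^ (L - Suc s))"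
  have ww: "z ^ (2 ^ (L - s)) = w\<^sup>2"
  proof -
    have "L - s = Suc (L - Suc s)" using Suc.prems by simp
    then show ?thesis by (simp add: w_def power_mult[symmetric] mult.commute)
  qed
  have w_half: "w ^ (2 ^ s) = -1"
  proof -
    obtain l where "L = Suc l" using Suc.prems by (cases L) auto
    then show ?thesis
      using primitive_root_half_power[of l z] assms(1) Suc.prems
      by (simp add: w_def power_mult[symmetric] power_add[symmetric])
  qed
  have IH1: "m < 2 ^ s \<Longrightarrow> M1 (b + m) = (\<Sum>j<2 ^ s. M (b + bit_reverse s j) * w\<^sup>2 ^ (j * m))"
    and IH1': "i < 2 ^ L \<Longrightarrow> i \<notin> {b..<b + 2 ^ s} \<Longrightarrow> M1 i = M i" for m i
    using Suc.IH[of b M] Suc.prems unfolding M1_def ww by auto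
  have IH2: "m < 2 ^ s \<Longrightarrow> M2 (b + 2 ^ s + m)
      = (\<Sum>j<2 ^ s. M1 (b + 2 ^ s + bit_reverse s j) * w\<^sup>2 ^ (j * m))"
    and IH2': "i < 2 ^ L \<Longrightarrow> i \<notin> {b + 2 ^ s..<b + 2 ^ s + 2 ^ s} \<Longrightarrow> M2 i = M1 i" for m i
    using Suc.IH[of "b + 2 ^ s" M1] Suc.prems unfolding M2_def ww by auto
  note B = execute_butterflies[OF Suc.prems(2), where \<omega> = \<omega> and z = z and M = M2, folded M3_def w_def]
  define E where "E m = (\<Sum>j<2 ^ s. M (b + bit_reverse s j) * w\<^sup>2 ^ (j * m))" for m
  define O' where "O' m = (\<Sum>j<2 ^ s. M (b + 2 ^ s + bit_reverse s j) * w\<^sup>2 ^ (j * m))" for m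
  have E: "M2 (b + m) = E m" if "m < 2 ^ s" for m
    using that Suc.prems by (simp add: IH2' IH1 E_def)
  have O': "M2 (b + 2 ^ s + m) = O' m" if "m < 2 ^ s" for m
    unfolding O'_def IH2[OF that]
  proof (intro sum.cong refl arg_cong2[of _ _ _ _ "(*)"] IH1')
    fix j
    show "b + 2 ^ s + bit_reverse s j < 2 ^ L"
      using Suc.prems bit_reverse_less[of s j] by simp
  qed simp
  have split_sum: "(\<Sum>j<2 ^ Suc s. M (b + bit_reverse (Suc s) j) * w ^ (j * m)) = E m + w ^ m * O' m"
    for m
  proof -
    have "(\<Sum>j<2 ^ s. M (b + bit_reverse (Suc s) (2 * j + 1)) * w ^ ((2 * j + 1) * m)) = w ^ m * O' m"
      unfolding O'_def sum_distrib_left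
    proof (intro sum.cong refl)
      fix j
      have "bit_reverse (Suc s) (2 * j + 1) = 2 ^ s + bit_reverse s j"
        by simp
      moreover have "w ^ ((2 * j + 1) * m) = w ^ m * w\<^sup>2 ^ (j * m)"
        by (simp add: power_add power_mult[symmetric] mult.assoc)
      ultimately show "M (b + bit_reverse (Suc s) (2 * j + 1)) * w ^ ((2 * j + 1) * m)
          = w ^ m * (M (b + 2 ^ s + bit_reverse s j) * w\<^sup>2 ^ (j * m))"
        by (simp only: add.assoc mult.left_commute)
    qed
    moreover have "(\<Sum>j<2 ^ s. M (b + bit_reverse (Suc s) (2 * j)) * w ^ (2 * j * m)) = E m"
      unfolding E_def by (intro sum.cong refl) (simp add: power_mult[symmetric] mult.assoc)
    ultimately show ?thesis
      by (simp only: power_Suc sum_even_odd)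
  qed
  have "M3 (b + m) = E m + w ^ m * O' m" if "m < 2 ^ Suc s" for m
  proof (cases "m < 2 ^ s")
    case True
    then show ?thesis by (simp add: B E O')
  next
    case False
    define k where "k = m - 2 ^ s"
    have k: "k < 2 ^ s" "m = 2 ^ s + k" using False that by (auto simp: k_def)
    \<comment> \<open>Both half-size transforms are periodic, since \<open>w\<^sup>2\<close> has order \<open>2 ^ s\<close>.\<close>
    have per: "w\<^sup>2 ^ (j * (2 ^ s + k)) = w\<^sup>2 ^ (j * k)" for j
    proof -
      have "w\<^sup>2 ^ (2 ^ s) = 1"
        using w_half by (metis power_mult mult.commute power2_minus one_power2)
      then have "w\<^sup>2 ^ (j * 2 ^ s) = 1"
        by (metis power_mult mult.commute power_one)
      then show ?thesis by (simp add: distrib_left power_add)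
    qed
    have "E m = E k" "O' m = O' k"
      by (simp_all add: E_def O'_def k(2) per)
    moreover have "w ^ m = - (w ^ k)"
      using k(2) w_half by (simp add: power_add)
    moreover have "M3 (b + m) = E k - w ^ k * O' k"
      using B(2)[OF k(1)] k E O' by (simp add: add.assoc)
    ultimately show ?thesis by simp
  qed
  moreover have "M3 i = M i" if "i < 2 ^ L" "i \<notin> {b..<b + 2 ^ Suc s}" for i
  proof -
    have "M3 i = M2 i" using B(3) that by blast
    also have "\<dots> = M1 i" using that by (intro IH2') auto
    also have "\<dots> = M i" using that by (intro IH1') auto
    finally show ?thesis .
  qed
  ultimately show ?case
    by (simp only: cooley_tukey_program.simps execute_append split_sum
        flip: M1_def M2_def M3_def w_def) blast
qed simp

lemma execute_scaling:
  "execute \<omega> z (map (\<lambda>m. Mul m (Cell m) (Literal q)) [0..<K]) M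
     = (\<lambda>i. if i < K then M i * of_rat q else M i)"
  by (induction K) auto

lemma fft_program_correct:
  assumes "primitive_root_of_unity (2 ^ L) z"
  shows "map (execute \<omega> z (fft_program L) M) [0..<2 ^ L] = dft (2 ^ L) z (map M [0..<2 ^ L])"
proof -
  have "execute \<omega> z (fft_program L) M m = 1 / of_nat (2 ^ L) * (\<Sum>j<2 ^ L. M j * z ^ (j * m))"
    if "m < 2 ^ L" for m
  proof -
    define M1 where "M1 = execute \<omega> z (bit_reversal_program L) M"
    have "execute \<omega> z (cooley_tukey_program L L 0) M1 m
        = (\<Sum>j<2 ^ L. M1 (bit_reverse L j) * z ^ (j * m))"
      using execute_cooley_tukey[OF assms order_refl, where b = 0 and \<omega> = \<omega> and M = M1] that by simp
    also have "\<dots> = (\<Sum>j<2 ^ L. M j * z ^ (j * m))"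
      by (intro sum.cong refl)
        (simp add: M1_def execute_bit_reversal bit_reverse_less bit_reverse_involution)
    finally show ?thesis
      using that
      by (simp add: fft_program_def execute_scaling M1_def of_rat_divide of_rat_power)
  qed
  then show ?thesis
    by (simp add: dft_def)
qed

lemma algorithm_P_program_correct:
  assumes "primitive_root_of_unity (2 ^ L) z" "n < 2 ^ L"
  shows "map (execute \<omega> z (algorithm_P_program n L) M) [0..<n + 1] = algorithm_P n (2 ^ L) \<omega> z"
proof -
  let ?M = "execute \<omega> z (evaluation_program n (2 ^ L)) M"
  have "map (execute \<omega> z (algorithm_P_program n L) M) [0..<2 ^ L]
      = dft (2 ^ L) z (map ?M [0..<2 ^ L])"
    using fft_program_correct[OF assms(1), of \<omega> ?M] by (simp add: algorithm_P_program_def)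
  also have "map ?M [0..<2 ^ L] = evaluation n (2 ^ L) \<omega> z"
    using assms(1) unfolding primitive_root_of_unity_def
    by (intro evaluation_program_correct) auto
  finally have "take (n + 1) (map (execute \<omega> z (algorithm_P_program n L) M) [0..<2 ^ L])
      = algorithm_P n (2 ^ L) \<omega> z"
    by (simp add: algorithm_P_def)
  then show ?thesis
    using assms(2) by (simp add: take_map del: upt_Suc)
qed


section \<open>Operation counts\<close>

lemma additions_simps [simp]:
  "additions [] = 0"
  "additions (i # prg) = (if is_addition i then 1 else 0) + additions prg"
  "additions (prg @ prg') = additions prg + additions prg'"
  "additions (replicate m i) = (if is_addition i then m else 0)"
  by (simp_all add: additions_def)

lemma multiplications_simps [simp]:
  "multiplications [] = 0"
  "multiplications (i # prg) = (if is_multiplication i then 1 else 0) + multiplications prg"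
  "multiplications (prg @ prg') = multiplications prg + multiplications prg'"
  "multiplications (replicate m i) = (if is_multiplication i then m else 0)"
  by (simp_all add: multiplications_def)

lemma operations_concat:
  "additions (concat prgs) = sum_list (map additions prgs)"
  "multiplications (concat prgs) = sum_list (map multiplications prgs)"
  by (induction prgs) simp_all

lemma operations_bit_reversal:
  "additions (bit_reversal_program L) = 0"
  "multiplications (bit_reversal_program L) = 0"
  by (auto simp: bit_reversal_program_def operations_concat comp_def sum_list_eq_0_iff)

lemma operations_scaling:
  "additions (map (\<lambda>m. Mul m (Cell m) (Literal q)) ms) = 0"
  "multiplications (map (\<lambda>m. Mul m (Cell m) (Literal q)) ms) = length ms"
  by (induction ms) simp_all

lemma operations_butterflies:
  "additions (butterflies_program L s b) = 2 * 2 ^ s"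
  "multiplications (butterflies_program L s b) = (L - Suc s) + 2 * 2 ^ s"
  by (simp_all add: butterflies_program_def operations_concat comp_def sum_list_triv)

lemma additions_cooley_tukey: "additions (cooley_tukey_program L s b) = s * 2 ^ s"
  by (induction s arbitrary: b) (simp_all add: operations_butterflies algebra_simps)

text \<open>Besides the \<open>s * 2 ^ s\<close> multiplications in the butterflies, each of the \<open>2 ^ s - 1\<close>
  combining steps recomputes its root of unity with at most \<open>L\<close> squarings. Adding \<open>L\<close> on the left
  turns the bound \<open>s * 2 ^ s + L * (2 ^ s - 1)\<close> into one that doubles from step to step.\<close>

lemma multiplications_cooley_tukey:
  "multiplications (cooley_tukey_program L s b) + L \<le> (s + L) * 2 ^ s"
proof (induction s arbitrary: b)
  case (Suc s)
  have "multiplications (cooley_tukey_program L (Suc s) b) + L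
      \<le> (multiplications (cooley_tukey_program L s b) + L)
        + (multiplications (cooley_tukey_program L s (b + 2 ^ s)) + L) + 2 * 2 ^ s"
    by (simp add: operations_butterflies)
  also have "\<dots> \<le> (s + L) * 2 ^ s + (s + L) * 2 ^ s + 2 * 2 ^ s"
    by (intro add_mono Suc order_refl)
  finally show ?case by (simp add: algebra_simps)
qed simp

lemma operations_evaluation:
  "additions (evaluation_program n N) = n * N"
  "multiplications (evaluation_program n N) = (N - 1) + N * (n + 1)"
  by (simp_all add: evaluation_program_def operations_concat comp_def sum_list_triv del: upt_Suc)

lemma additions_algorithm_P:
  "additions (algorithm_P_program n L) = n * 2 ^ L + L * 2 ^ L"
  by (simp add: algorithm_P_program_def fft_program_def operations_evaluation
      operations_bit_reversal additions_cooley_tukey operations_scaling)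

lemma multiplications_algorithm_P:
  "n * 2 ^ L \<le> multiplications (algorithm_P_program n L)"
  "multiplications (algorithm_P_program n L) \<le> n * 2 ^ L + (2 * L + 3) * 2 ^ L"
proof -
  have count: "multiplications (algorithm_P_program n L)
      = (2 ^ L - 1) + (n * 2 ^ L + 2 ^ L) + multiplications (cooley_tukey_program L L 0) + 2 ^ L"
    by (simp add: algorithm_P_program_def fft_program_def operations_evaluation
        operations_bit_reversal operations_scaling mult.commute)
  then show "n * 2 ^ L \<le> multiplications (algorithm_P_program n L)"
    by linarith
  have "(2 * L + 3) * 2 ^ L = (L + L) * 2 ^ L + 3 * 2 ^ L"
    by (simp add: distrib_right)
  then show "multiplications (algorithm_P_program n L) \<le> n * 2 ^ L + (2 * L + 3) * 2 ^ L"
    using count multiplications_cooley_tukey[of L L 0] by linarith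
qed


section \<open>Storage\<close>

lemma cells_evaluation:
  "(\<Union>i\<in>set (evaluation_program n N). instruction_cells i) \<subseteq> {..<N + 5}"
  "{..<N} \<subseteq> (\<Union>i\<in>set (evaluation_program n N). instruction_cells i)"
proof -
  show "(\<Union>i\<in>set (evaluation_program n N). instruction_cells i) \<subseteq> {..<N + 5}"
    by (auto simp: evaluation_program_def simp del: upt_Suc split: if_splits)
  show "{..<N} \<subseteq> (\<Union>i\<in>set (evaluation_program n N). instruction_cells i)"
  proof
    fix j assume "j \<in> {..<N}"
    then have "Copy j (Literal 1) \<in> set (evaluation_program n N)"
      by (simp add: evaluation_program_def del: upt_Suc)
    then show "j \<in> (\<Union>i\<in>set (evaluation_program n N). instruction_cells i)"
      by (rule UN_I) simp
  qed
qed

lemma cells_bit_reversal: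
  "(\<Union>i\<in>set (bit_reversal_program L). instruction_cells i) \<subseteq> {..<2 ^ L + 5}"
  using bit_reverse_less[of L]
  by (auto simp: bit_reversal_program_def trans_less_add1 split: if_splits)

lemma cells_butterflies:
  assumes "b + 2 ^ Suc s \<le> 2 ^ L"
  shows "(\<Union>i\<in>set (butterflies_program L s b). instruction_cells i) \<subseteq> {..<2 ^ L + 5}"
  using assms by (auto simp: butterflies_program_def)

lemma cells_cooley_tukey:
  assumes "b + 2 ^ s \<le> 2 ^ L"
  shows "(\<Union>i\<in>set (cooley_tukey_program L s b). instruction_cells i) \<subseteq> {..<2 ^ L + 5}"
  using assms
proof (induction s arbitrary: b)
  case (Suc s)
  then show ?case
    using Suc.IH[of b] Suc.IH[of "b + 2 ^ s"] cells_butterflies[of b s L] by simp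
qed simp

lemma storage_algorithm_P:
  "2 ^ L \<le> storage (algorithm_P_program n L)"
  "storage (algorithm_P_program n L) \<le> 2 ^ L + 5"
proof -
  let ?C = "\<Union>i\<in>set (algorithm_P_program n L). instruction_cells i"
  have upper: "?C \<subseteq> {..<2 ^ L + 5}"
    using cells_evaluation(1)[of n "2 ^ L"] cells_bit_reversal[of L] cells_cooley_tukey[of 0 L L]
    by (auto simp: algorithm_P_program_def fft_program_def)
  have lower: "{..<2 ^ L} \<subseteq> ?C"
    using cells_evaluation(2)[of "2 ^ L" n] by (auto simp: algorithm_P_program_def)
  show "storage (algorithm_P_program n L) \<le> 2 ^ L + 5"
    using card_mono[OF _ upper] by (simp add: storage_def)
  show "2 ^ L \<le> storage (algorithm_P_program n L)"
    using card_mono[OF finite_subset[OF upper] lower] by (simp add: storage_def)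
qed


section \<open>Asymptotic bounds and the theorem\<close>

lemma bigo_principalI:
  assumes "\<And>x. x \<in> A \<Longrightarrow> norm (f x) \<le> c * norm (g x)"
  shows "f \<in> O[principal A](g)"
  by (rule bigoI[of _ c]) (simp add: eventually_principal assms)

lemma fft_sizes_bounds:
  assumes "(n, L) \<in> fft_sizes"
  shows "1 \<le> L" "L \<le> n" "1 \<le> n" "n < 2 ^ L" "2 ^ L \<le> 2 * n"
proof -
  have "2 * L \<le> 2 ^ L" if "1 \<le> L" for L :: nat
    using that by (induction L rule: dec_induct) auto
  moreover show "1 \<le> L"
    using assms by (cases L) (auto simp: fft_sizes_def)
  ultimately show "L \<le> n"
    using assms by (fastforce simp: fft_sizes_def)
  show "1 \<le> n" "n < 2 ^ L" "2 ^ L \<le> 2 * n"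
    using assms by (auto simp: fft_sizes_def)
qed

lemma real_le_two_ln_power: "real L \<le> 2 * ln (2 ^ L)"
proof -
  have "1 \<le> ln (4 :: real)"
    using exp_le by (simp add: ln_ge_iff)
  also have "ln (4 :: real) = 2 * ln 2"
    using ln_realpow[of 2 2] by simp
  finally show ?thesis
    using mult_left_mono[of 1 "2 * ln 2" "real L"] by (simp add: ln_realpow mult_ac)
qed

lemma additions_asymptotics:
  "(\<lambda>(n, L). real (additions (algorithm_P_program n L)) - real n * 2 ^ L)
     \<in> O[principal fft_sizes](\<lambda>(n, L). 2 ^ L * ln (2 ^ L))"
proof (rule bigo_principalI[where c = 2], clarify)
  fix n L :: nat
  show "norm (real (additions (algorithm_P_program n L)) - real n * 2 ^ L)
      \<le> 2 * norm (2 ^ L * ln (2 ^ L) :: real)"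
    using mult_left_mono[OF real_le_two_ln_power[of L], of "2 ^ L"]
    by (simp add: additions_algorithm_P abs_mult algebra_simps)
qed

lemma multiplications_asymptotics:
  "(\<lambda>(n, L). real (multiplications (algorithm_P_program n L)) - real n * 2 ^ L)
     \<in> O[principal fft_sizes](\<lambda>(n, L). 2 ^ L * ln (2 ^ L))"
proof (rule bigo_principalI[where c = 10], clarify)
  fix n L :: nat
  assume "(n, L) \<in> fft_sizes"
  note bounds = fft_sizes_bounds[OF this]
  have "real n * 2 ^ L \<le> real (multiplications (algorithm_P_program n L))"
    using multiplications_algorithm_P(1)[of n L] by (metis of_nat_le_iff of_nat_mult of_nat_numeral of_nat_power)
  moreover have "real (multiplications (algorithm_P_program n L))
      \<le> real (n * 2 ^ L + (2 * L + 3) * 2 ^ L)"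
    using multiplications_algorithm_P(2)[of n L] of_nat_le_iff by blast
  moreover have "real (2 * L + 3) * 2 ^ L \<le> (10 * ln (2 ^ L)) * 2 ^ L"
    using real_le_two_ln_power[of L] bounds(1) by (intro mult_right_mono) auto
  ultimately show "norm (real (multiplications (algorithm_P_program n L)) - real n * 2 ^ L)
      \<le> 10 * norm (2 ^ L * ln (2 ^ L) :: real)"
    by (simp add: abs_mult algebra_simps)
qed

lemma operations_asymptotics:
  "(\<lambda>(n, L). real (additions (algorithm_P_program n L) + multiplications (algorithm_P_program n L)))
     \<in> O[principal fft_sizes](\<lambda>(n, L). (real n)\<^sup>2)"
proof (rule bigo_principalI[where c = 16], clarify)
  fix n L :: nat
  assume "(n, L) \<in> fft_sizes"
  note bounds = fft_sizes_bounds[OF this]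
  have "additions (algorithm_P_program n L) + multiplications (algorithm_P_program n L)
      \<le> (2 * n + 3 * L + 3) * 2 ^ L"
    using multiplications_algorithm_P(2)[of n L] by (simp add: additions_algorithm_P algebra_simps)
  also have "\<dots> \<le> (8 * n) * (2 * n)"
    using bounds by (intro mult_mono) auto
  also have "\<dots> = 16 * n\<^sup>2"
    by (simp add: power2_eq_square)
  finally show "norm (real (additions (algorithm_P_program n L)
        + multiplications (algorithm_P_program n L))) \<le> 16 * norm ((real n)\<^sup>2)"
    by (metis (mono_tags, lifting) of_nat_le_iff of_nat_mult of_nat_numeral of_nat_power
        real_norm_def abs_of_nat)
qed

lemma storage_asymptotics:
  "(\<lambda>(n, L). real (storage (algorithm_P_program n L)) - 2 ^ L)
     \<in> O[principal fft_sizes](\<lambda>(n, L). 1)"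
  "(\<lambda>(n, L). real (storage (algorithm_P_program n L)))
     \<in> O[principal fft_sizes](\<lambda>(n, L). real n)"
proof -
  have S: "2 ^ L \<le> real (storage (algorithm_P_program n L))"
    "real (storage (algorithm_P_program n L)) \<le> 2 ^ L + 5" for n L
    using storage_algorithm_P(1)[of L n, THEN of_nat_mono[where 'a = real]]
      storage_algorithm_P(2)[of n L, THEN of_nat_mono[where 'a = real]]
    by simp_all
  show "(\<lambda>(n, L). real (storage (algorithm_P_program n L)) - 2 ^ L)
     \<in> O[principal fft_sizes](\<lambda>(n, L). 1)"
  proof (rule bigo_principalI[where c = 5], clarify)
    fix n L :: nat
    show "norm (real (storage (algorithm_P_program n L)) - 2 ^ L) \<le> 5 * norm (1 :: real)"
      using S[where n = n and L = L] by simp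
  qed
  show "(\<lambda>(n, L). real (storage (algorithm_P_program n L)))
     \<in> O[principal fft_sizes](\<lambda>(n, L). real n)"
  proof (rule bigo_principalI[where c = 7], clarify)
    fix n L :: nat
    assume "(n, L) \<in> fft_sizes"
    note bounds = fft_sizes_bounds[OF this]
    have "storage (algorithm_P_program n L) \<le> 7 * n"
      using storage_algorithm_P(2)[of n L] bounds by linarith
    then show "norm (real (storage (algorithm_P_program n L))) \<le> 7 * norm (real n)"
      by simp
  qed
qed

theorem mainTheorem1:
  shows
    "(\<forall>(n::nat) (N::nat) (\<omega>::nat \<Rightarrow> complex) (z::complex) (P::complex poly).
       1 \<le> n \<and> (\<forall>k\<in>{1..n}. \<omega> k \<noteq> 0) \<and> P = (\<Prod>k=1..n. [:- \<omega> k, 1:]) \<and>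
       n < N \<and> N \<le> 2 * n \<and> primitive_root_of_unity N z
       \<longrightarrow>
       (\<forall>m\<le>n. coeff P m = 1 / of_nat N * (\<Sum>j<N. poly P (z powi (- int j)) * z ^ (j * m))) \<and>
       (\<forall>m. n < m \<and> m < N \<longrightarrow>
          1 / of_nat N * (\<Sum>j<N. poly P (z powi (- int j)) * z ^ (j * m)) = 0) \<and>
       algorithm_P n N \<omega> z = map (coeff P) [0..<n + 1] \<and>
       (\<forall>L. N = 2 ^ L \<longrightarrow>
          (\<forall>M. map (execute \<omega> z (evaluation_program n N) M) [0..<N] = evaluation n N \<omega> z) \<and>
          (\<forall>M. map (execute \<omega> z (fft_program L) M) [0..<N] = dft N z (map M [0..<N])) \<and>
          (\<forall>M. map (execute \<omega> z (algorithm_P_program n L) M) [0..<n + 1]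
                 = map (coeff P) [0..<n + 1]))) \<and>
     ((\<lambda>(n, L). real (additions (algorithm_P_program n L)) - real n * 2 ^ L)
       \<in> O[principal fft_sizes](\<lambda>(n, L). 2 ^ L * ln (2 ^ L))) \<and>
     ((\<lambda>(n, L). real (multiplications (algorithm_P_program n L)) - real n * 2 ^ L)
       \<in> O[principal fft_sizes](\<lambda>(n, L). 2 ^ L * ln (2 ^ L))) \<and>
     ((\<lambda>(n, L). real (additions (algorithm_P_program n L) + multiplications (algorithm_P_program n L)))
       \<in> O[principal fft_sizes](\<lambda>(n, L). (real n)\<^sup>2)) \<and>
     ((\<lambda>(n, L). real (storage (algorithm_P_program n L)) - 2 ^ L)
       \<in> O[principal fft_sizes](\<lambda>(n, L). 1)) \<and>
     ((\<lambda>(n, L). real (storage (algorithm_P_program n L)))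
       \<in> O[principal fft_sizes](\<lambda>(n, L). real n))"
  (is "(\<forall>n N \<omega> z P. ?correct n N \<omega> z P) \<and> ?asymptotics")
proof (rule conjI)
  show "\<forall>n N \<omega> z P. ?correct n N \<omega> z P"
  proof (intro allI impI, elim conjE)
    fix n N :: nat and \<omega> :: "nat \<Rightarrow> complex" and z :: complex and P :: "complex poly"
    assume P: "P = (\<Prod>k=1..n. [:- \<omega> k, 1:])" and N: "n < N"
      and z: "primitive_root_of_unity N z"
    have deg: "degree P = n"
      by (simp only: P degree_prod_monic_linear)
    have formula: "1 / of_nat N * (\<Sum>j<N. poly P (z powi (- int j)) * z ^ (j * m)) = coeff P m"
      if "m < N" for m
      using that deg N z by (intro interpolation_formula) auto
    have result: "algorithm_P n N \<omega> z = map (coeff P) [0..<n + 1]"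
      unfolding P by (rule algorithm_P_correct[OF z N])
    have root: "z ^ N = 1"
      using z unfolding primitive_root_of_unity_def by simp
    show "(\<forall>m\<le>n. coeff P m = 1 / of_nat N * (\<Sum>j<N. poly P (z powi (- int j)) * z ^ (j * m))) \<and>
       (\<forall>m. n < m \<and> m < N \<longrightarrow>
          1 / of_nat N * (\<Sum>j<N. poly P (z powi (- int j)) * z ^ (j * m)) = 0) \<and>
       algorithm_P n N \<omega> z = map (coeff P) [0..<n + 1] \<and>
       (\<forall>L. N = 2 ^ L \<longrightarrow>
          (\<forall>M. map (execute \<omega> z (evaluation_program n N) M) [0..<N] = evaluation n N \<omega> z) \<and>
          (\<forall>M. map (execute \<omega> z (fft_program L) M) [0..<N] = dft N z (map M [0..<N])) \<and>
          (\<forall>M. map (execute \<omega> z (algorithm_P_program n L) M) [0..<n + 1]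
                 = map (coeff P) [0..<n + 1]))"
    proof (intro conjI allI impI)
      fix m assume "m \<le> n"
      then show "coeff P m = 1 / of_nat N * (\<Sum>j<N. poly P (z powi (- int j)) * z ^ (j * m))"
        using formula[of m] N by simp
    next
      fix m assume "n < m \<and> m < N"
      then show "1 / of_nat N * (\<Sum>j<N. poly P (z powi (- int j)) * z ^ (j * m)) = 0"
        using formula[of m] deg by (simp add: coeff_eq_0)
    next
      show "algorithm_P n N \<omega> z = map (coeff P) [0..<n + 1]"
        by (rule result)
    next
      fix M :: memory
      show "map (execute \<omega> z (evaluation_program n N) M) [0..<N] = evaluation n N \<omega> z"
        using root N by (intro evaluation_program_correct) auto
    next
      fix L and M :: memory
      assume L: "N = 2 ^ L"
      show "map (execute \<omega> z (fft_program L) M) [0..<N] = dft N z (map M [0..<N])"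
        using fft_program_correct z unfolding L by blast
      show "map (execute \<omega> z (algorithm_P_program n L) M) [0..<n + 1] = map (coeff P) [0..<n + 1]"
        using algorithm_P_program_correct[of L z n \<omega> M] z N result unfolding L by simp
    qed
  qed
  show ?asymptotics
    by (intro conjI additions_asymptotics multiplications_asymptotics operations_asymptotics
        storage_asymptotics)
qed

end
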